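(* For all integers $n\ge 1$ and $r$ with $1\le r\le n+1$, $$N(n,r)\ge M(n,r).$$
   Context: $B_n=2^{[n]}$ is the Boolean lattice of all subsets of $[n]=\{1,\dots,n\}$ ordered by inclusion. A chain is a set of pairwise comparable elements; a chain $C$ covers a chain $D$ if $D\subseteq C$. For $1\le r\le n+1$, $N(n,r)$ is the least number of chains in $B_n$ such that every strict chain $F_1\subset F_2\subset\cdots\subset F_r$ of size $r$ in $B_n$ is covered by at least one of them. Let $\mathcal A_{n,r}$ be the set of integer vectors $(a_0,a_1,\dots,a_r)$ with $a_0,a_r\ge 0$, $a_i\ge 1$ for $1\le i\le r-1$, and $a_0+\cdots+a_r=n$. Define $M(n,r)=\max_{(a_0,\dots,a_r)\in\mathcal A_{n,r}}\binom{n}{a_0,a_1,\dots,a_r}$, where $\binom{n}{a_0,\dots,a_r}=\frac{n!}{a_0!\cdots a_r!}$. *)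

theory Defs
  imports Complex_Main
begin

definition boolean_lattice :: "nat \<Rightarrow> nat set set" where
  "boolean_lattice n = Pow {1..n}"

(* A strict chain F_1 < ... < F_r is identified with its set {F_1, ..., F_r} of
   r pairwise comparable elements. *)
definition covers_strict_chains :: "nat \<Rightarrow> nat \<Rightarrow> nat set set set \<Rightarrow> bool" where
  "covers_strict_chains n r \<C> \<longleftrightarrow>
     (\<forall>C\<in>\<C>. subset.chain (boolean_lattice n) C) \<and>
     (\<forall>D. subset.chain (boolean_lattice n) D \<and> card D = r \<longrightarrow> (\<exists>C\<in>\<C>. D \<subseteq> C))"

definition chain_cover_number :: "nat \<Rightarrow> nat \<Rightarrow> nat" where
  "chain_cover_number n r =
     (LEAST k. \<exists>\<C>. finite \<C> \<and> card \<C> = k \<and> covers_strict_chains n r \<C>)"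

(* The vector (a_0, ..., a_r) is the list a of length r + 1; a_0, a_r \<ge> 0 holds
   because the entries are natural numbers. *)
definition admissible_vectors :: "nat \<Rightarrow> nat \<Rightarrow> nat list set" where
  "admissible_vectors n r =
     {a. length a = r + 1 \<and> (\<forall>i. 1 \<le> i \<and> i \<le> r - 1 \<longrightarrow> a ! i \<ge> 1) \<and> sum_list a = n}"

definition multinomial :: "nat \<Rightarrow> nat list \<Rightarrow> nat" where
  "multinomial n a = fact n div prod_list (map fact a)"

definition max_multinomial :: "nat \<Rightarrow> nat \<Rightarrow> nat" where
  "max_multinomial n r = Max (multinomial n ` admissible_vectors n r)"

(* The next lemmas show that the operators LEAST, div and Max above are applied where
   they have their intended meaning. *)

lemma chain_cover_exists:
  "\<exists>\<C>. finite \<C> \<and> card \<C> = chain_cover_number n r \<and> covers_strict_chains n r \<C>"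
proof -
  let ?\<C> = "{C. subset.chain (boolean_lattice n) C}"
  have "?\<C> \<subseteq> Pow (boolean_lattice n)"
    by (auto simp: subset_chain_def)
  then have "finite ?\<C>"
    by (rule finite_subset) (simp add: boolean_lattice_def)
  moreover have "covers_strict_chains n r ?\<C>"
    unfolding covers_strict_chains_def by blast
  ultimately have "\<exists>k \<C>. finite \<C> \<and> card \<C> = k \<and> covers_strict_chains n r \<C>"
    by blast
  then show ?thesis
    unfolding chain_cover_number_def by (rule LeastI_ex)
qed

lemma prod_list_fact_dvd: "prod_list (map fact a) dvd (fact (sum_list a) :: nat)"
proof (induction a)
  case (Cons x a)
  have "fact x * prod_list (map fact a) dvd (fact x * fact (sum_list a) :: nat)"
    using Cons.IH by (rule mult_dvd_mono[OF dvd_refl])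
  also have "\<dots> dvd fact (x + sum_list a)"
    by (rule fact_fact_dvd_fact)
  finally show ?case
    by simp
qed simp

lemma finite_admissible_vectors: "finite (admissible_vectors n r)"
proof (rule finite_subset)
  show "admissible_vectors n r \<subseteq> {a. set a \<subseteq> {..n} \<and> length a = r + 1}"
    by (auto simp: admissible_vectors_def member_le_sum_list)
qed (rule finite_lists_length_eq, simp)

lemma admissible_vectors_nonempty:
  assumes "1 \<le> r" "r \<le> n + 1"
  shows "admissible_vectors n r \<noteq> {}"
proof -
  let ?a = "(n + 1 - r) # replicate (r - 1) 1 @ [0]"
  have "?a ! i \<ge> 1" if "1 \<le> i" "i \<le> r - 1" for i
    using that by (cases i) (auto simp: nth_append)
  then have "?a \<in> admissible_vectors n r"
    using assms by (simp add: admissible_vectors_def sum_list_replicate)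
  then show ?thesis
    by blast
qed

end

theory Submission
  imports Defs
begin

text \<open>
  Fix an admissible vector \<open>a = (a\<^sub>0, \<dots>, a\<^sub>r)\<close> and look only at the chains
  \<open>F\<^sub>1 \<subset> \<dots> \<subset> F\<^sub>r\<close> in which \<open>F\<^sub>i\<close> has
  \<open>a\<^sub>0 + \<dots> + a\<^bsub>i-1\<^esub>\<close> elements. Choosing the differences
  \<open>F\<^sub>1, F\<^sub>2 - F\<^sub>1, \<dots>\<close> one after the other shows that there are exactly
  as many of them as the multinomial coefficient of \<open>a\<close> (\<open>card_flags\<close>).
  On the other hand, two different members of a chain of finite sets have different cardinalities,
  so a chain contains at most one set of each size and therefore covers at most one chain with the
  sizes prescribed by \<open>a\<close> (\<open>flags_eq_if_in_chain\<close>). Hence every cover needs at least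
  as many chains as the multinomial coefficient of \<open>a\<close>, for each \<open>a\<close>.
\<close>

text \<open>
  The entries of the vector are the sizes of the successive differences, starting from \<open>B\<close>;
  an entry 0 repeats a set. The last entry is not inspected: it belongs to the step into
  \<open>V\<close>, whose size is determined by the others once the entries sum to
  \<open>card (V - B)\<close>. Lists rather than sets of sets make the first set of a chain, on which
  the counting recursion branches, directly accessible.
\<close>
fun flags :: "'a set \<Rightarrow> 'a set \<Rightarrow> nat list \<Rightarrow> 'a set list set" where
  "flags V B [] = {}"
| "flags V B [x] = {[]}"
| "flags V B (x # y # a) =
     (\<Union>F\<in>{F. B \<subseteq> F \<and> F \<subseteq> V \<and> card F = card B + x}. (#) F ` flags V F (y # a))"

lemma card_sets_between:
  assumes "finite V" "B \<subseteq> V"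
  shows "card {F. B \<subseteq> F \<and> F \<subseteq> V \<and> card F = card B + x} = card (V - B) choose x"
proof -
  have fin: "finite B"
    using assms finite_subset by blast
  have "bij_betw (\<lambda>A. B \<union> A) {A. A \<subseteq> V - B \<and> card A = x}
          {F. B \<subseteq> F \<and> F \<subseteq> V \<and> card F = card B + x}"
  proof (rule bij_betw_byWitness[where f' = "\<lambda>F. F - B"])
    show "(\<union>) B ` {A. A \<subseteq> V - B \<and> card A = x}
        \<subseteq> {F. B \<subseteq> F \<and> F \<subseteq> V \<and> card F = card B + x}"
    proof clarify
      fix A assume A: "A \<subseteq> V - B"
      then have "finite A" "B \<inter> A = {}"
        using assms finite_subset by blast+
      then have "card (B \<union> A) = card B + card A"
        using fin by (simp add: card_Un_disjoint)
      then show "B \<subseteq> B \<union> A \<and> B \<union> A \<subseteq> V \<and> card (B \<union> A) = card B + card A"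
        using A assms by blast
    qed
  qed (use fin in \<open>auto simp: card_Diff_subset\<close>)
  then show ?thesis
    using assms by (simp add: bij_betw_same_card[symmetric] n_subsets)
qed

lemma finite_flags: "finite V \<Longrightarrow> finite (flags V B a)"
  by (induction V B a rule: flags.induct) auto

text \<open>
  The induction step is \<open>(x + s)! = (x + s choose x) x! s!\<close>: the binomial coefficient counts
  the choices of the first set, and the induction hypothesis counts the continuations above it.
\<close>
lemma card_flags:
  assumes "finite V" "B \<subseteq> V" "a \<noteq> []" "sum_list a = card (V - B)"
  shows "card (flags V B a) * prod_list (map fact a) = fact (sum_list a)"
  using assms
proof (induction V B a rule: flags.induct)
  case (3 V B x y a)
  let ?S = "{F. B \<subseteq> F \<and> F \<subseteq> V \<and> card F = card B + x}"
  let ?s = "sum_list (y # a)" and ?p = "prod_list (map fact (y # a)) :: nat"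
  have "finite ?S"
    using 3(2) by (auto intro: finite_subset[of _ "Pow V"])
  have step: "card (flags V F (y # a)) * ?p = fact ?s" if F: "F \<in> ?S" for F
  proof -
    have "finite F" "finite B"
      using F 3(2,3) finite_subset by auto
    then have "card (V - F) = ?s"
      using F 3(2,3,5) by (auto simp: card_Diff_subset)
    then show ?thesis
      using 3(1)[OF F] 3(2) F by simp
  qed
  have "card (flags V B (x # y # a)) = (\<Sum>F\<in>?S. card ((#) F ` flags V F (y # a)))"
    unfolding flags.simps
    by (rule card_UN_disjoint) (use \<open>finite ?S\<close> 3(2) in \<open>auto simp: finite_flags\<close>)
  also have "\<dots> = (\<Sum>F\<in>?S. card (flags V F (y # a)))"
    by (simp add: card_image)
  finally have "card (flags V B (x # y # a)) * ?p = (\<Sum>F\<in>?S. fact ?s)"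
    using step by (simp only: sum_distrib_right) (rule sum.cong, simp_all)
  also have "\<dots> = (x + ?s choose x) * fact ?s"
    using card_sets_between[OF 3(2,3), of x] 3(5) by simp
  finally have "card (flags V B (x # y # a)) * prod_list (map fact (x # y # a))
      = fact x * fact ?s * (x + ?s choose x)"
    by (simp add: ac_simps)
  also have "\<dots> = fact (x + ?s)"
    using binomial_fact_lemma[of x "x + ?s"] by simp
  finally show ?case
    by simp
qed auto

lemma length_flags: "Fs \<in> flags V B a \<Longrightarrow> length Fs + 1 = length a"
  by (induction V B a arbitrary: Fs rule: flags.induct) auto

lemma flags_subset: "Fs \<in> flags V B a \<Longrightarrow> F \<in> set Fs \<Longrightarrow> F \<subseteq> V"
proof (induction V B a arbitrary: Fs rule: flags.induct)
  case (3 V B x y a)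
  then obtain G Gs where "G \<subseteq> V" "B \<subseteq> G" "card G = card B + x"
    and "Fs = G # Gs" "Gs \<in> flags V G (y # a)"
    by auto
  with 3 show ?case
    by (cases "F = G") simp_all
qed auto

lemma flags_strict_above:
  assumes "Fs \<in> flags V B a" "0 \<notin> set (butlast a)"
  shows "sorted_wrt (\<subset>) (B # Fs)"
  using assms
proof (induction V B a arbitrary: Fs rule: flags.induct)
  case (3 V B x y a)
  then obtain F Gs where F: "B \<subseteq> F" "F \<subseteq> V" "card F = card B + x"
    and Gs: "Fs = F # Gs" "Gs \<in> flags V F (y # a)"
    by auto
  have "sorted_wrt (\<subset>) (F # Gs)"
    using 3 F Gs by auto
  moreover have "B \<subset> F"
    using F 3(3) by auto
  ultimately show ?case
    using Gs by auto
qed auto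

text \<open>
  The first entry may vanish, as \<open>F\<^sub>1 = B\<close> is allowed, and so may the last one.
\<close>
lemma flags_strict:
  assumes "Fs \<in> flags V B a" "0 \<notin> set (butlast (tl a))"
  shows "sorted_wrt (\<subset>) Fs"
proof (cases "(V, B, a)" rule: flags.cases)
  case (3 V' B' x y a')
  then obtain F Gs where "Fs = F # Gs" "Gs \<in> flags V F (y # a')"
    using assms by auto
  then show ?thesis
    using flags_strict_above[of Gs V F "y # a'"] assms 3 by simp
qed (use assms in auto)

text \<open>
  Each size is a partial sum of the vector added to \<open>card B\<close>. The induction moves the lower
  bounds of the two lists apart, so only their cardinalities are assumed equal.
\<close>
lemma flags_same_sizes:
  assumes "Fs \<in> flags V B a" "Gs \<in> flags V B' a" "card B = card B'"
  shows "map card Fs = map card Gs"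
  using assms
proof (induction V B a arbitrary: B' Fs Gs rule: flags.induct)
  case (3 V B x y a)
  obtain F Fs' where F: "B \<subseteq> F" "F \<subseteq> V" "card F = card B + x"
    and Fs: "Fs = F # Fs'" "Fs' \<in> flags V F (y # a)"
    using 3(2) by auto
  obtain G Gs' where G: "card G = card B' + x"
    and Gs: "Gs = G # Gs'" "Gs' \<in> flags V G (y # a)"
    using 3(3) by auto
  have "map card Fs' = map card Gs'"
    using 3(1)[of F Fs' Gs' G] F G Fs(2) Gs(2) 3(4) by simp
  then show ?case
    using F G Fs Gs 3(4) by simp
qed auto

lemma inj_on_card_chain:
  assumes "subset.chain (Pow V) C" "finite V"
  shows "inj_on card C"
proof (rule inj_onI)
  fix F G assume "F \<in> C" "G \<in> C" and eq: "card F = card G"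
  with assms have "finite F" "finite G" "F \<subseteq> G \<or> G \<subseteq> F"
    by (auto simp: subset_chain_def intro: finite_subset)
  with eq show "F = G"
    by (metis card_subset_eq)
qed

lemma flags_eq_if_in_chain:
  assumes "subset.chain (Pow V) C" "finite V"
    and "Fs \<in> flags V B a" "Gs \<in> flags V B a" "set Fs \<subseteq> C" "set Gs \<subseteq> C"
  shows "Fs = Gs"
proof (rule map_inj_on)
  show "map card Fs = map card Gs"
    using assms flags_same_sizes by blast
  show "inj_on card (set Fs \<union> set Gs)"
    using assms by (blast intro: inj_on_subset[OF inj_on_card_chain])
qed

lemma flags_chain:
  assumes "Fs \<in> flags V B a" "0 \<notin> set (butlast (tl a))"
  shows "subset.chain (Pow V) (set Fs)" and "card (set Fs) + 1 = length a"
proof -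
  have sorted: "sorted_wrt (\<subset>) Fs"
    using assms by (rule flags_strict)
  then have "F \<subseteq> G \<or> G \<subseteq> F" if "F \<in> set Fs" "G \<in> set Fs" for F G
    using that by (induction Fs) auto
  then show "subset.chain (Pow V) (set Fs)"
    using flags_subset[OF assms(1)] by (simp add: subset_chain_def subset_iff[of "set Fs"])
  have "distinct Fs"
    using sorted by (induction Fs) auto
  then show "card (set Fs) + 1 = length a"
    using length_flags[OF assms(1)] by (simp add: distinct_card)
qed

lemma multinomial_le_card_cover:
  assumes a: "a \<in> admissible_vectors n r"
    and C: "finite \<C>" "covers_strict_chains n r \<C>"
  shows "multinomial n a \<le> card \<C>"
proof -
  let ?V = "{1..n}" and ?\<F> = "flags {1..n} {} a"
  have len: "length a = r + 1" and sum: "sum_list a = n"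
    and pos: "\<And>i. 1 \<le> i \<Longrightarrow> i \<le> r - 1 \<Longrightarrow> a ! i \<ge> 1"
    using a by (auto simp: admissible_vectors_def)
  have inner: "0 \<notin> set (butlast (tl a))"
  proof
    assume "0 \<in> set (butlast (tl a))"
    then obtain i where "i < r - 1" "a ! Suc i = 0"
      using len by (auto simp: in_set_conv_nth nth_butlast nth_tl)
    then show False
      using pos[of "Suc i"] by simp
  qed
  have "\<exists>C. C \<in> \<C> \<and> set Fs \<subseteq> C" if "Fs \<in> ?\<F>" for Fs
    using C(2) flags_chain[OF that inner] len
    unfolding covers_strict_chains_def boolean_lattice_def by auto
  then obtain f where f: "\<And>Fs. Fs \<in> ?\<F> \<Longrightarrow> f Fs \<in> \<C> \<and> set Fs \<subseteq> f Fs"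
    by metis
  have "inj_on f ?\<F>"
  proof (rule inj_onI)
    fix Fs Gs assume *: "Fs \<in> ?\<F>" "Gs \<in> ?\<F>" "f Fs = f Gs"
    have "subset.chain (Pow ?V) (f Fs)"
      using C(2) f[OF *(1)] unfolding covers_strict_chains_def boolean_lattice_def by blast
    then show "Fs = Gs"
      using f[OF *(1)] f[OF *(2)] * by (intro flags_eq_if_in_chain[of ?V "f Fs"]) auto
  qed
  then have "card ?\<F> \<le> card \<C>"
    using f C(1) by (intro card_inj_on_le) auto
  moreover have "a \<noteq> []"
    using len by auto
  then have "fact n = card ?\<F> * prod_list (map fact a)"
    using card_flags[of ?V "{}" a] sum by simp
  then have "multinomial n a = card ?\<F>"
    by (auto simp: multinomial_def prod_list_zero_iff)
  ultimately show ?thesis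
    by simp
qed

theorem proposition1p2:
  fixes n r :: nat
  assumes "n \<ge> 1" and "1 \<le> r" and "r \<le> n + 1"
  shows "chain_cover_number n r \<ge> max_multinomial n r"
proof -
  obtain \<C> where "finite \<C>" "card \<C> = chain_cover_number n r" "covers_strict_chains n r \<C>"
    using chain_cover_exists by blast
  then have "\<forall>a \<in> admissible_vectors n r. multinomial n a \<le> chain_cover_number n r"
    using multinomial_le_card_cover by metis
  then show ?thesis
    unfolding max_multinomial_def
    using finite_admissible_vectors admissible_vectors_nonempty[OF assms(2,3)] by simp
qed

end
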